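(* Let $C,D\subset[0,1]$ be two general Cantor sets (with endpoints $0$ and $1$), with aperture ratios $\mathrm{Ap}(C)$ and $\mathrm{Ap}(D)$. Let $g:[0,1]\times[0,1]\to\mathbb{R}$ be a continuous, piecewise $C^1$ function such that at every point of differentiability $$\frac{\partial g}{\partial\alpha}>0,\qquad \frac{\partial g}{\partial\beta}>0,$$ so that $g$ is increasing in both $\alpha$ and $\beta$, with minimum $g(0,0)$ and maximum $g(1,1)$. Suppose that for every $(\alpha,\beta)\in[0,1]^2$ (except on the exceptional set where differentiability fails) $$\left|\frac{\partial g}{\partial\alpha}\Big/\frac{\partial g}{\partial\beta}\right|\in\left[\mathrm{Ap}(C),\mathrm{Ap}(C)^{-1}\right]\cap\left[\mathrm{Ap}(D),\mathrm{Ap}(D)^{-1}\right].$$ Then $$\{g(\alpha,\beta) : \alpha\in C,\ \beta\in D\}=[g(0,0),g(1,1)].$$ The same statement holds with the interval $[0,1]$ replaced throughout by any interval $[x_1,x_2]$ with $x_1<x_2$ (so $C,D\subset[x_1,x_2]$ are general Cantor sets with endpoints $x_1,x_2$, $g$ is defined on $[x_1,x_2]^2$, and the conclusion is that the image is $[g(x_1,x_1),g(x_2,x_2)]$).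
   Context: General Cantor set in $[0,1]$ with endpoints $0,1$: $C=\bigcap_{n\ge0}C_n$, where $C_0=[0,1]$ and, if $C_n=\bigcup_{k=1}^{2^n}[a_{n,k},d_{n,k}]$, then $C_{n+1}=\bigcup_{k=1}^{2^n}([a_{n,k},b_{n,k}]\cup[c_{n,k},d_{n,k}])$ for some $a_{n,k}<b_{n,k}<c_{n,k}<d_{n,k}$. (For $[x_1,x_2]$ in place of $[0,1]$, start from $C_0=[x_1,x_2]$.) The aperture ratio, computed with respect to the given construction, is $$\mathrm{Ap}(C)=\sup_{n,k}\max\left(\frac{c_{n,k}-b_{n,k}}{b_{n,k}-a_{n,k}},\frac{c_{n,k}-b_{n,k}}{d_{n,k}-c_{n,k}}\right).$$ Piecewise $C^1$: the set where differentiability of $g$ fails is at most a finite union of differentiable arcs, where each arc is either a straight segment or meets any straight segment at most finitely many times; this is understood to ensure that the restriction of $g$ to any straight segment is a piecewise $C^1$ function on a closed interval, satisfying the Newton–Leibniz formula. *)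

theory Defs
  imports "HOL-Analysis.Analysis"
begin

text \<open>
  A construction of a general Cantor set: at stage \<open>n\<close> there are \<open>2 ^ n\<close> intervals
  \<open>[lend n k, rend n k]\<close>, \<open>1 \<le> k \<le> 2 ^ n\<close>, and the open gap \<open>(lgap n k, rgap n k)\<close> is removed
  from the \<open>k\<close>-th of them. The two remaining pieces get the indices \<open>2 * k - 1\<close> (left) and
  \<open>2 * k\<close> (right) at stage \<open>n + 1\<close>. Values at other \<open>k\<close> are irrelevant. Interval lengths are not
  required to tend to zero.
\<close>

record cantor_construction =
  lend :: "nat \<Rightarrow> nat \<Rightarrow> real"
  lgap :: "nat \<Rightarrow> nat \<Rightarrow> real"
  rgap :: "nat \<Rightarrow> nat \<Rightarrow> real"
  rend :: "nat \<Rightarrow> nat \<Rightarrow> real"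

definition is_cantor_construction :: "real \<Rightarrow> real \<Rightarrow> cantor_construction \<Rightarrow> bool" where
  "is_cantor_construction x1 x2 K \<longleftrightarrow>
     lend K 0 1 = x1 \<and> rend K 0 1 = x2 \<and>
     (\<forall>n. \<forall>k\<in>{1..2 ^ n}.
        lend K n k < lgap K n k \<and> lgap K n k < rgap K n k \<and> rgap K n k < rend K n k \<and>
        lend K (Suc n) (2 * k - 1) = lend K n k \<and> rend K (Suc n) (2 * k - 1) = lgap K n k \<and>
        lend K (Suc n) (2 * k) = rgap K n k \<and> rend K (Suc n) (2 * k) = rend K n k)"

definition cantor_stage :: "cantor_construction \<Rightarrow> nat \<Rightarrow> real set" where
  "cantor_stage K n = (\<Union>k\<in>{1..2 ^ n}. {lend K n k..rend K n k})"

definition cantor_set :: "cantor_construction \<Rightarrow> real set" where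
  "cantor_set K = (\<Inter>n. cantor_stage K n)"

text \<open>The supremum may be infinite, hence the extended reals.\<close>

definition aperture :: "cantor_construction \<Rightarrow> ereal" where
  "aperture K = (SUP (n, k) \<in> (SIGMA n:UNIV. {1..2 ^ n}).
     ereal (max ((rgap K n k - lgap K n k) / (lgap K n k - lend K n k))
                ((rgap K n k - lgap K n k) / (rend K n k - rgap K n k))))"

definition admissible_arc :: "(real \<Rightarrow> real \<times> real) \<Rightarrow> bool" where
  "admissible_arc \<gamma> \<longleftrightarrow> arc \<gamma> \<and> \<gamma> differentiable_on {0..1} \<and>
     ((\<exists>p q. path_image \<gamma> = closed_segment p q) \<or>
      (\<forall>p q. finite (path_image \<gamma> \<inter> closed_segment p q)))"

text \<open>
  Derivatives are taken within the domain \<open>S\<close>, so they are one-sided on its boundary.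
  The restriction of \<open>g\<close> to a segment lying inside an exceptional arc is not controlled by the
  first two conditions; hence the third one.
\<close>

definition piecewise_C1_on :: "(real \<times> real \<Rightarrow> real) \<Rightarrow> (real \<times> real) set \<Rightarrow> bool" where
  "piecewise_C1_on g S \<longleftrightarrow>
     continuous_on S g \<and>
     (\<exists>\<Gamma>. finite \<Gamma> \<and> (\<forall>\<gamma>\<in>\<Gamma>. admissible_arc \<gamma>) \<and>
        (\<exists>g' :: real \<times> real \<Rightarrow> (real \<times> real) \<Rightarrow>\<^sub>L real.
           (\<forall>p \<in> S - (\<Union>\<gamma>\<in>\<Gamma>. path_image \<gamma>).
              (g has_derivative blinfun_apply (g' p)) (at p within S)) \<and>
           continuous_on (S - (\<Union>\<gamma>\<in>\<Gamma>. path_image \<gamma>)) g')) \<and>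
     (\<forall>p q. closed_segment p q \<subseteq> S \<longrightarrow>
        (g \<circ> linepath p q) piecewise_C1_differentiable_on {0..1})"

text \<open>The Newton--Leibniz formula on segments is a consequence of the definition.\<close>

lemma piecewise_C1_on_Newton_Leibniz:
  assumes "piecewise_C1_on g S" "closed_segment p q \<subseteq> S"
  shows "((\<lambda>t. vector_derivative (g \<circ> linepath p q) (at t)) has_integral (g q - g p)) {0..1}"
proof -
  let ?f = "g \<circ> linepath p q"
  from assms have "?f piecewise_C1_differentiable_on {0..1}"
    unfolding piecewise_C1_on_def by blast
  then obtain T where T: "finite T" "continuous_on {0..1} ?f" "?f C1_differentiable_on ({0..1} - T)"
    unfolding piecewise_C1_differentiable_on_def by blast
  have "((\<lambda>t. vector_derivative ?f (at t)) has_integral (?f 1 - ?f 0)) {0..1}"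
  proof (rule fundamental_theorem_of_calculus_interior_strong[OF T(1) _ _ T(2)])
    fix x assume "x \<in> {0<..<1} - T"
    then have "?f differentiable at x" using T(3) unfolding C1_differentiable_on_eq by auto
    then show "(?f has_vector_derivative vector_derivative ?f (at x)) (at x)"
      by (simp add: vector_derivative_works)
  qed simp
  then show ?thesis by (simp add: linepath_0' linepath_1')
qed

text \<open>Partial derivatives on the square \<open>[x1, x2] \<times> [x1, x2]\<close>, one-sided at its edges.\<close>

definition partial_fst :: "real \<Rightarrow> real \<Rightarrow> (real \<times> real \<Rightarrow> real) \<Rightarrow> real \<Rightarrow> real \<Rightarrow> real" where
  "partial_fst x1 x2 g \<alpha> \<beta> = vector_derivative (\<lambda>s. g (s, \<beta>)) (at \<alpha> within {x1..x2})"

definition partial_snd :: "real \<Rightarrow> real \<Rightarrow> (real \<times> real \<Rightarrow> real) \<Rightarrow> real \<Rightarrow> real \<Rightarrow> real" where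
  "partial_snd x1 x2 g \<alpha> \<beta> = vector_derivative (\<lambda>s. g (\<alpha>, s)) (at \<beta> within {x1..x2})"

end

theory Submission
  imports Defs
begin

text \<open>
  Write \<open>r\<close> for the larger of the two aperture ratios. The slope condition says that moving against
  the level sets is governed by comparing lengths only: if \<open>a' - a \<le> r * (b' - b)\<close>, then the gain of
  \<open>g\<close> from raising the second coordinate from \<open>b\<close> to \<open>b'\<close> outweighs the loss from lowering the first
  one from \<open>a'\<close> to \<open>a\<close>, so \<open>g (a', b) \<le> g (a, b')\<close>, and likewise with the coordinates exchanged
  (the predicate \<open>exchange\<close>). Hence, if \<open>t\<close> lies between the values of \<open>g\<close> at the lower left and the
  upper right corner of a box \<open>I \<times> J\<close>, and \<open>U\<close> is a gap in \<open>I\<close> of length at most \<open>r\<close> times that of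
  \<open>J\<close>, then \<open>t\<close> still lies between the corner values of one of the two boxes that remain when
  \<open>U \<times> J\<close> is cut out (\<open>linked_split\<close>).

  Cutting in the order of the construction can get stuck, because a later gap may be longer than an
  earlier one, and then the opposite interval may already be too short. Cutting out the
  longest remaining gap of either factor always works: of two gaps of a Cantor construction, the one
  removed later has a bridge separating it from the other, so they lie at distance at least
  the smaller length divided by \<open>r\<close>. This symmetric condition (\<open>gaps_spread\<close>) does not
  refer to the order of removal, and it makes every interval that ends at an already
  removed, longer gap long enough for all remaining cuts (\<open>linked_level_point\<close>).
  A stage has finitely many gaps, so the cutting ends in a point of the product of the two stages at
  which \<open>g\<close> equals \<open>t\<close>; compactness gives such a point in the product of the Cantor sets
  (\<open>cantor_level_point\<close>).

  It remains to integrate the slope condition along segments, which may run inside the exceptional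
  arcs. A segment is the limit of its images under homotheties with a centre off its
  line; these lie on distinct parallel lines, and all but finitely many of them meet the arcs in
  finitely many points. There \<open>g\<close> is monotone by the chain rule, and continuity gives the
  inequality in the limit (\<open>le_along_segment\<close>).
\<close>

section \<open>Finite families of gaps\<close>

definition gap_complement :: "real \<Rightarrow> real \<Rightarrow> (real \<times> real) set \<Rightarrow> real set" where
  "gap_complement a d U = {x \<in> {a..d}. \<forall>u v. (u, v) \<in> U \<longrightarrow> x \<notin> {u<..<v}}"

text \<open>
  The gap with end points \<open>u\<close> and \<open>v\<close> is encoded as the pair \<open>(u, v)\<close>. In the second conjunct
  at most one of \<open>u' - v\<close> and \<open>u - v'\<close> is positive, and it is then the distance of the two gaps; so
  the disjunction bounds that distance below without naming the left one.
\<close>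

definition gaps_spread :: "real \<Rightarrow> real \<Rightarrow> real \<Rightarrow> (real \<times> real) set \<Rightarrow> bool" where
  "gaps_spread r a d U \<longleftrightarrow>
     (\<forall>u v. (u, v) \<in> U \<longrightarrow> u < v \<and> v - u \<le> r * (u - a) \<and> v - u \<le> r * (d - v)) \<and>
     (\<forall>u v u' v'. (u, v) \<in> U \<longrightarrow> (u', v') \<in> U \<longrightarrow> (u, v) \<noteq> (u', v') \<longrightarrow>
        min (v - u) (v' - u') \<le> r * (u' - v) \<or> min (v - u) (v' - u') \<le> r * (u - v'))"

lemma gaps_spreadD:
  assumes "gaps_spread r a d U" "(u, v) \<in> U"
  shows "u < v" "v - u \<le> r * (u - a)" "v - u \<le> r * (d - v)"
  using assms unfolding gaps_spread_def by blast+

lemma gaps_spread_pairD: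
  assumes "gaps_spread r a d U" "(u, v) \<in> U" "(u', v') \<in> U" "(u, v) \<noteq> (u', v')"
  shows "min (v - u) (v' - u') \<le> r * (u' - v) \<or> min (v - u) (v' - u') \<le> r * (u - v')"
  using assms unfolding gaps_spread_def by blast

lemma pos_of_pos_le_mult:
  fixes r x y :: real
  assumes "0 < r" "0 < y" "y \<le> r * x"
  shows "0 < x"
  using assms by (meson less_le_trans zero_less_mult_pos)

lemma gaps_spread_inside:
  assumes "0 < r" "gaps_spread r a d U" "(u, v) \<in> U"
  shows "a < u" "v < d"
  using gaps_spreadD[OF assms(2,3)] pos_of_pos_le_mult[OF assms(1), of "v - u"] by force+

text \<open>
  The reflection \<open>x \<mapsto> - x\<close> exchanges the roles of the left and right part when a gap is cut out.
\<close>

lemma gaps_spread_reflect: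
  assumes "gaps_spread r a d U"
  shows "gaps_spread r (- d) (- a) ((\<lambda>(u, v). (- v, - u)) ` U)"
  unfolding gaps_spread_def
proof (intro conjI allI impI; (elim imageE)?)
  fix u v z assume z: "(u, v) = (case z of (u, v) \<Rightarrow> (- v, - u))" "z \<in> U"
  then have m: "(- v, - u) \<in> U" by (auto split: prod.splits)
  show "u < v" "v - u \<le> r * (u - - d)" "v - u \<le> r * (- a - v)"
    using gaps_spreadD[OF assms m] by (simp_all add: algebra_simps)
next
  fix u v u' v' z z'
  assume z: "(u, v) = (case z of (u, v) \<Rightarrow> (- v, - u))" "z \<in> U"
    and z': "(u', v') = (case z' of (u, v) \<Rightarrow> (- v, - u))" "z' \<in> U"
    and ne: "(u, v) \<noteq> (u', v')"
  from z z' have m: "(- v, - u) \<in> U" "(- v', - u') \<in> U" by (auto split: prod.splits)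
  show "min (v - u) (v' - u') \<le> r * (u' - v) \<or> min (v - u) (v' - u') \<le> r * (u - v')"
    using gaps_spread_pairD[OF assms m] ne by (auto simp: algebra_simps)
qed

text \<open>
  The step of the construction, from bottom to top: a gap of the left part keeps its distance to the
  right end \<open>b\<close> of that part, hence to everything beyond \<open>b\<close>, in terms of its own length alone. This
  bounds its distance to the new gap and to the gaps of the right part, however long those are.
\<close>

lemma gaps_spread_join:
  assumes r: "0 < r" and bc: "b < c" "c - b \<le> r * (b - a)" "c - b \<le> r * (d - c)"
    and V: "gaps_spread r a b V" and W: "gaps_spread r c d W"
  shows "gaps_spread r a d (insert (b, c) (V \<union> W))"
proof -
  have ab: "a < b" and cd: "c < d"
    using pos_of_pos_le_mult[OF r _ bc(2)] pos_of_pos_le_mult[OF r _ bc(3)] bc(1) by simp_all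
  have mono: "y \<le> r * x'" if "y \<le> r * x" "x \<le> x'" for x x' y
    using that r by (meson mult_left_mono less_imp_le order_trans)
  have Vend: "v - u \<le> r * (x - v)" if "(u, v) \<in> V" "b \<le> x" for u v x
    using gaps_spreadD(3)[OF V that(1)] by (rule mono) (use that in simp)
  have Wend: "v - u \<le> r * (u - x)" if "(u, v) \<in> W" "x \<le> c" for u v x
    using gaps_spreadD(2)[OF W that(1)] by (rule mono) (use that in simp)
  have Vin: "v < b" if "(u, v) \<in> V" for u v using gaps_spread_inside[OF r V that] by simp
  have Win: "c < u" if "(u, v) \<in> W" for u v using gaps_spread_inside[OF r W that] by simp
  show ?thesis
    unfolding gaps_spread_def
  proof (intro conjI allI impI)
    fix u v assume "(u, v) \<in> insert (b, c) (V \<union> W)"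
    then consider "u = b" "v = c" | "(u, v) \<in> V" | "(u, v) \<in> W" by auto
    then have "u < v \<and> v - u \<le> r * (u - a) \<and> v - u \<le> r * (d - v)"
    proof cases
      case 1 then show ?thesis using bc by simp
    next
      case 2 then show ?thesis using gaps_spreadD[OF V 2] Vend[OF 2, of d] bc(1) cd by auto
    next
      case 3 then show ?thesis using gaps_spreadD[OF W 3] Wend[OF 3, of a] bc(1) ab by auto
    qed
    then show "u < v" "v - u \<le> r * (u - a)" "v - u \<le> r * (d - v)" by auto
  next
    fix u v u' v'
    assume mem: "(u, v) \<in> insert (b, c) (V \<union> W)" "(u', v') \<in> insert (b, c) (V \<union> W)"
      and ne: "(u, v) \<noteq> (u', v')"
    consider "(u, v) \<in> V" "(u', v') \<in> V" | "(u, v) \<in> W" "(u', v') \<in> W"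
      | "(u, v) \<in> V" "b \<le> u'" | "(u', v') \<in> V" "b \<le> u"
      | "(u, v) \<in> W" "v' \<le> c" | "(u', v') \<in> W" "v \<le> c"
    proof -
      have Vb: "u < b \<and> v < b" if "(u, v) \<in> V" for u v
        using Vin[OF that] gaps_spreadD(1)[OF V that] by simp
      have Wc: "c < u \<and> c < v" if "(u, v) \<in> W" for u v
        using Win[OF that] gaps_spreadD(1)[OF W that] by simp
      consider "(u, v) = (b, c)" | "(u, v) \<in> V" | "(u, v) \<in> W"
        using mem(1) by blast
      then show ?thesis
      proof cases
        case 1
        then have "(u', v') \<in> V \<or> (u', v') \<in> W" using mem(2) ne by blast
        then show ?thesis using 1 that(4,6) by auto
      next
        case 2
        have "(u', v') \<in> V \<or> b \<le> u'" using mem(2) Wc bc(1) by force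
        then show ?thesis using 2 that(1,3) by blast
      next
        case 3
        have "(u', v') \<in> W \<or> v' \<le> c" using mem(2) Vb bc(1) by force
        then show ?thesis using 3 that(2,5) by blast
      qed
    qed
    then show "min (v - u) (v' - u') \<le> r * (u' - v) \<or> min (v - u) (v' - u') \<le> r * (u - v')"
    proof cases
      case 1 then show ?thesis using gaps_spread_pairD[OF V] ne by blast
    next
      case 2 then show ?thesis using gaps_spread_pairD[OF W] ne by blast
    next
      case 3 then show ?thesis using Vend[of u v u'] by auto
    next
      case 4 then show ?thesis using Vend[of u' v' u] by auto
    next
      case 5 then show ?thesis using Wend[of u v v'] by auto
    next
      case 6 then show ?thesis using Wend[of u' v' v] by auto
    qed
  qed
qed

text \<open>
  Once a longest gap is cut out, it may serve as an end of the interval: its distance to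
  any other gap is bounded below by the length of the other gap, which is the smaller of the two.
\<close>

lemma gaps_spread_left:
  assumes r: "0 < r" and U: "gaps_spread r a d U" and uv: "(u, v) \<in> U"
    and longest: "\<And>x y. (x, y) \<in> U \<Longrightarrow> y - x \<le> v - u"
  shows "gaps_spread r a u {(x, y) \<in> U. y \<le> u}" (is ?spread)
    and "gap_complement a u {(x, y) \<in> U. y \<le> u} \<subseteq> gap_complement a d U" (is ?sub)
proof -
  have right_end: "y - x \<le> r * (u - y)" if "(x, y) \<in> U" "y \<le> u" for x y
  proof -
    have "(x, y) \<noteq> (u, v)" using that gaps_spreadD(1)[OF U uv] by auto
    moreover have "\<not> y - x \<le> r * (x - v)"
      using pos_of_pos_le_mult[OF r, of "y - x" "x - v"] gaps_spreadD(1)[OF U that(1)]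
        gaps_spreadD(1)[OF U uv] that(2) by linarith
    ultimately show ?thesis
      using gaps_spread_pairD[OF U that(1) uv] longest[OF that(1)] by (auto simp: min_def)
  qed
  show ?spread
    unfolding gaps_spread_def
    using gaps_spreadD[OF U] gaps_spread_pairD[OF U] right_end by auto
  have away: "y \<le> u \<or> v \<le> x" if "(x, y) \<in> U" "(x, y) \<noteq> (u, v)" for x y
  proof -
    have pos: "0 < min (y - x) (v - u)"
      using gaps_spreadD(1)[OF U that(1)] gaps_spreadD(1)[OF U uv] by simp
    from gaps_spread_pairD[OF U that(1) uv that(2)] have "0 < u - y \<or> 0 < x - v"
      using pos_of_pos_le_mult[OF r pos] by blast
    then show ?thesis by linarith
  qed
  show ?sub
  proof
    fix z assume z: "z \<in> gap_complement a u {(x, y) \<in> U. y \<le> u}"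
    have "z \<notin> {x<..<y}" if "(x, y) \<in> U" for x y
    proof (cases "y \<le> u")
      case True
      then show ?thesis using z that unfolding gap_complement_def by auto
    next
      case False
      with away[OF that] have "u \<le> x"
        using gaps_spreadD(1)[OF U uv] by (cases "(x, y) = (u, v)") auto
      then show ?thesis using z unfolding gap_complement_def by auto
    qed
    then show "z \<in> gap_complement a d U"
      using z gaps_spread_inside[OF r U uv] gaps_spreadD(1)[OF U uv]
      unfolding gap_complement_def by auto
  qed
qed

lemma gaps_spread_right:
  assumes r: "0 < r" and U: "gaps_spread r a d U" and uv: "(u, v) \<in> U"
    and longest: "\<And>x y. (x, y) \<in> U \<Longrightarrow> y - x \<le> v - u"
  shows "gaps_spread r v d {(x, y) \<in> U. v \<le> x}"
    and "gap_complement v d {(x, y) \<in> U. v \<le> x} \<subseteq> gap_complement a d U"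
proof -
  let ?R = "\<lambda>(u :: real, v :: real). (- v, - u)"
  have img: "(x, y) \<in> ?R ` W \<longleftrightarrow> (- y, - x) \<in> W" for x y W
    by (force simp: image_iff split: prod.splits)
  have left: "gaps_spread r (- d) (- v) {(x, y) \<in> ?R ` U. y \<le> - v}"
    "gap_complement (- d) (- v) {(x, y) \<in> ?R ` U. y \<le> - v} \<subseteq> gap_complement (- d) (- a) (?R ` U)"
    using gaps_spread_left[OF r gaps_spread_reflect[OF U], of "- v" "- u"] uv longest
    by (simp_all add: img) (metis add.commute diff_minus_eq_add uminus_add_conv_diff)+
  have flip: "?R ` {(x, y) \<in> ?R ` U. y \<le> - v} = {(x, y) \<in> U. v \<le> x}"
    by (auto simp: img)
  show "gaps_spread r v d {(x, y) \<in> U. v \<le> x}"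
    using gaps_spread_reflect[OF left(1)] unfolding flip by simp
  have neg: "- x \<in> gap_complement (- q) (- p) (?R ` W)" if "x \<in> gap_complement p q W" for x p q W
  proof -
    have "- x \<notin> {u<..<v}" if "(u, v) \<in> ?R ` W" for u v
    proof -
      have "x \<notin> {- v<..<- u}"
        using that \<open>x \<in> gap_complement p q W\<close> unfolding gap_complement_def img by blast
      then show ?thesis by auto
    qed
    then show ?thesis using that unfolding gap_complement_def by auto
  qed
  have flip': "{(x, y) \<in> ?R ` U. y \<le> - v} = ?R ` {(x, y) \<in> U. v \<le> x}" by (auto simp: img)
  show "gap_complement v d {(x, y) \<in> U. v \<le> x} \<subseteq> gap_complement a d U"
  proof
    fix x assume "x \<in> gap_complement v d {(x, y) \<in> U. v \<le> x}"
    from neg[OF this] left(2) have "- x \<in> gap_complement (- d) (- a) (?R ` U)"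
      unfolding flip' by blast
    from neg[OF this] have "x \<in> gap_complement a d (?R ` ?R ` U)" by simp
    moreover have "?R ` ?R ` U = U" by (auto simp: img)
    ultimately show "x \<in> gap_complement a d U" by simp
  qed
qed

section \<open>Level sets between two gap families\<close>

text \<open>
  The situation that is preserved by cutting: each gap is short against the interval of the other
  factor, and the level \<open>t\<close> lies between the values at the lower left and upper right corner.
\<close>

definition linked :: "real \<Rightarrow> (real \<Rightarrow> real \<Rightarrow> real) \<Rightarrow> real \<Rightarrow>
    real \<Rightarrow> real \<Rightarrow> (real \<times> real) set \<Rightarrow> real \<Rightarrow> real \<Rightarrow> (real \<times> real) set \<Rightarrow> bool" where
  "linked r g t a d U e h V \<longleftrightarrow>
     finite U \<and> gaps_spread r a d U \<and> (\<forall>u v. (u, v) \<in> U \<longrightarrow> v - u \<le> r * (h - e)) \<and>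
     finite V \<and> gaps_spread r e h V \<and> (\<forall>u v. (u, v) \<in> V \<longrightarrow> v - u \<le> r * (d - a)) \<and>
     a \<le> d \<and> e \<le> h \<and> g a e \<le> t \<and> t \<le> g d h"

text \<open>
  The integrated form of the condition that the ratio of the partial derivatives lies between \<open>r\<close>
  and \<open>1 / r\<close>. It is invariant under exchanging the two coordinates.
\<close>

definition exchange :: "real \<Rightarrow> real set \<Rightarrow> (real \<Rightarrow> real \<Rightarrow> real) \<Rightarrow> bool" where
  "exchange r X g \<longleftrightarrow>
     (\<forall>a\<in>X. \<forall>a'\<in>X. \<forall>b\<in>X. \<forall>b'\<in>X. a \<le> a' \<longrightarrow> b \<le> b' \<longrightarrow>
        (a' - a \<le> r * (b' - b) \<longrightarrow> g a' b \<le> g a b') \<and>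
        (b' - b \<le> r * (a' - a) \<longrightarrow> g a b' \<le> g a' b))"

lemma exchange_swap: "exchange r X g \<Longrightarrow> exchange r X (\<lambda>y x. g x y)"
  unfolding exchange_def by blast

lemma linked_swap: "linked r g t a d U e h V \<Longrightarrow> linked r (\<lambda>y x. g x y) t e h V a d U"
  unfolding linked_def by blast

text \<open>
  The gap \<open>(u, v)\<close> is short against \<open>{e..h}\<close>, so the largest corner value \<open>g u h\<close> of the left box is
  at least the smallest corner value \<open>g v e\<close> of the right box, and the two ranges of values overlap.
  The remaining intervals are long against the other factor because the bridges of \<open>(u, v)\<close> are, and
  \<open>(u, v)\<close> is longest.
\<close>

lemma linked_split:
  assumes r: "0 < r" and L: "linked r g t a d U e h V"
    and g: "exchange r {x1..x2} g" and X: "{a..d} \<subseteq> {x1..x2}" "{e..h} \<subseteq> {x1..x2}"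
    and uv: "(u, v) \<in> U" and longest: "\<And>x y. (x, y) \<in> U \<union> V \<Longrightarrow> y - x \<le> v - u"
  shows "linked r g t a u {(x, y) \<in> U. y \<le> u} e h V \<or>
         linked r g t v d {(x, y) \<in> U. v \<le> x} e h V"
proof -
  have U: "gaps_spread r a d U" and eh: "e \<le> h" and ad: "a \<le> d"
    and t: "g a e \<le> t" "t \<le> g d h" and len: "v - u \<le> r * (h - e)"
    using L uv unfolding linked_def by auto
  have inside: "a < u" "u < v" "v < d"
    using gaps_spread_inside[OF r U uv] gaps_spreadD[OF U uv] by auto
  have Vl: "y - x \<le> r * (u - a)" "y - x \<le> r * (d - v)" if "(x, y) \<in> V" for x y
    using gaps_spreadD[OF U uv] longest[of x y] that by auto
  have "g v e \<le> g u h"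
    using g[unfolded exchange_def] inside eh ad len X by auto
  then consider "t \<le> g u h" | "g v e \<le> t" by linarith
  then show ?thesis
  proof cases
    case 1
    then have "linked r g t a u {(x, y) \<in> U. y \<le> u} e h V"
      using L gaps_spread_left(1)[OF r U uv] longest Vl(1) inside unfolding linked_def
      by (auto intro: finite_subset[of _ U])
    then show ?thesis ..
  next
    case 2
    then have "linked r g t v d {(x, y) \<in> U. v \<le> x} e h V"
      using L gaps_spread_right(1)[OF r U uv] longest Vl(2) inside unfolding linked_def
      by (auto intro: finite_subset[of _ U])
    then show ?thesis ..
  qed
qed

text \<open>
  Induction on the number of gaps: a longest gap of either factor is cut out. Without gaps the level
  \<open>t\<close> is attained since the box is connected.
\<close>

lemma linked_level_point:
  assumes r: "0 < r"
    and "linked r g t a d U e h V" "exchange r {x1..x2} g"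
    and "continuous_on ({x1..x2} \<times> {x1..x2}) (\<lambda>z. g (fst z) (snd z))"
    and "{a..d} \<subseteq> {x1..x2}" "{e..h} \<subseteq> {x1..x2}"
  shows "\<exists>x\<in>gap_complement a d U. \<exists>y\<in>gap_complement e h V. g x y = t"
  using assms(2-)
proof (induction "card U + card V" arbitrary: g a d U e h V rule: less_induct)
  case less
  \<comment> \<open>The cut in the first coordinate, for arbitrary \<open>g\<close> and intervals: a longest gap in the second
    coordinate is handled by the same statement after exchanging the coordinates.\<close>
  have split: "\<exists>x\<in>gap_complement a d U. \<exists>y\<in>gap_complement e h V. g x y = t"
    if card: "card U + card V = card U0 + card V0"
      and L: "linked r g t a d U e h V" and g: "exchange r {x1..x2} g"
      and cont: "continuous_on ({x1..x2} \<times> {x1..x2}) (\<lambda>z. g (fst z) (snd z))"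
      and X: "{a..d} \<subseteq> {x1..x2}" "{e..h} \<subseteq> {x1..x2}"
      and uv: "(u, v) \<in> U" and longest: "\<And>x y. (x, y) \<in> U \<union> V \<Longrightarrow> y - x \<le> v - u"
      and IH: "\<And>g' a' d' U' e' h' V'. card U' + card V' < card U0 + card V0 \<Longrightarrow>
        linked r g' t a' d' U' e' h' V' \<Longrightarrow> exchange r {x1..x2} g' \<Longrightarrow>
        continuous_on ({x1..x2} \<times> {x1..x2}) (\<lambda>z. g' (fst z) (snd z)) \<Longrightarrow>
        {a'..d'} \<subseteq> {x1..x2} \<Longrightarrow> {e'..h'} \<subseteq> {x1..x2} \<Longrightarrow>
        \<exists>x\<in>gap_complement a' d' U'. \<exists>y\<in>gap_complement e' h' V'. g' x y = t"
    for g a d U e h V U0 V0 u v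
  proof -
    have U: "gaps_spread r a d U" and fin: "finite U" using L unfolding linked_def by auto
    have inside: "a < u" "u < v" "v < d"
      using gaps_spread_inside[OF r U uv] gaps_spreadD[OF U uv] by auto
    have smaller: "card W + card V < card U0 + card V0" if "W \<subset> U" for W
      using psubset_card_mono[OF fin that] card by linarith
    have "(u, v) \<notin> {(x, y) \<in> U. y \<le> u}" "(u, v) \<notin> {(x, y) \<in> U. v \<le> x}"
      using inside by auto
    then have proper: "{(x, y) \<in> U. y \<le> u} \<subset> U" "{(x, y) \<in> U. v \<le> x} \<subset> U"
      using uv by blast+
    from linked_split[OF r L g X uv longest] show ?thesis
    proof
      assume "linked r g t a u {(x, y) \<in> U. y \<le> u} e h V"
      from IH[OF smaller[OF proper(1)] this g cont _ X(2)] inside X(1) have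
        "\<exists>x\<in>gap_complement a u {(x, y) \<in> U. y \<le> u}. \<exists>y\<in>gap_complement e h V. g x y = t"
        by (simp add: subset_iff)
      moreover have "gap_complement a u {(x, y) \<in> U. y \<le> u} \<subseteq> gap_complement a d U"
        using longest by (intro gaps_spread_left(2)[OF r U uv]) blast
      ultimately show ?thesis by blast
    next
      assume "linked r g t v d {(x, y) \<in> U. v \<le> x} e h V"
      from IH[OF smaller[OF proper(2)] this g cont _ X(2)] inside X(1) have
        "\<exists>x\<in>gap_complement v d {(x, y) \<in> U. v \<le> x}. \<exists>y\<in>gap_complement e h V. g x y = t"
        by (simp add: subset_iff)
      moreover have "gap_complement v d {(x, y) \<in> U. v \<le> x} \<subseteq> gap_complement a d U"
        using longest by (intro gaps_spread_right(2)[OF r U uv]) blast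
      ultimately show ?thesis by blast
    qed
  qed
  show ?case
  proof (cases "U \<union> V = {}")
    case True
    let ?G = "\<lambda>z. g (fst z) (snd z)"
    have "connected (?G ` ({a..d} \<times> {e..h}))"
      using less.prems by (intro connected_continuous_image connected_Times)
        (auto intro: continuous_on_subset)
    moreover have "g a e \<in> ?G ` ({a..d} \<times> {e..h})" "g d h \<in> ?G ` ({a..d} \<times> {e..h})"
      using less.prems(1) unfolding linked_def by (force intro: rev_image_eqI)+
    ultimately have "t \<in> ?G ` ({a..d} \<times> {e..h})"
      using less.prems(1) unfolding linked_def by (meson connected_contains_Icc atLeastAtMost_iff subsetD)
    then obtain x y where "x \<in> {a..d}" "y \<in> {e..h}" "g x y = t" by auto
    moreover have "gap_complement a d U = {a..d}" "gap_complement e h V = {e..h}"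
      using True unfolding gap_complement_def by auto
    ultimately show ?thesis by blast
  next
    case False
    have "finite (U \<union> V)" using less.prems(1) unfolding linked_def by simp
    then have fin: "finite ((\<lambda>(u, v). v - u) ` (U \<union> V))" by simp
    have "Max ((\<lambda>(u, v). v - u) ` (U \<union> V)) \<in> (\<lambda>(u, v). v - u) ` (U \<union> V)"
      using Max_in[OF fin] False by blast
    then obtain z where z: "z \<in> U \<union> V" "Max ((\<lambda>(u, v). v - u) ` (U \<union> V)) = (case z of (u, v) \<Rightarrow> v - u)"
      by blast
    obtain u v where "z = (u, v)" by (rule prod.exhaust)
    with z have uv: "(u, v) \<in> U \<union> V" and max: "v - u = Max ((\<lambda>(u, v). v - u) ` (U \<union> V))"
      by simp_all
    have longest: "y - x \<le> v - u" if "(x, y) \<in> U \<union> V" for x y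
      unfolding max by (rule Max_ge[OF fin]) (use that in force)
    show ?thesis
    proof (cases "(u, v) \<in> U")
      case True
      from split[OF refl less.prems True longest less.hyps] show ?thesis by blast
    next
      case False
      then have V: "(u, v) \<in> V" using uv by simp
      have cont: "continuous_on ({x1..x2} \<times> {x1..x2}) (\<lambda>z. g (snd z) (fst z))"
        using continuous_on_compose2[OF less.prems(3) continuous_on_swap, of "{x1..x2} \<times> {x1..x2}"]
        by (simp add: image_subset_iff)
      have long': "\<And>x y. (x, y) \<in> V \<union> U \<Longrightarrow> y - x \<le> v - u" using longest by blast
      from split[OF add.commute linked_swap[OF less.prems(1)] exchange_swap[OF less.prems(2)]
          cont less.prems(5,4) V long' less.hyps]
      show ?thesis by blast
    qed
  qed
qed

section \<open>Stages of a Cantor construction\<close>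

lemma cantor_construction_step:
  assumes "is_cantor_construction x1 x2 K" "k \<in> {1..2 ^ n}"
  shows "lend K n k < lgap K n k" "lgap K n k < rgap K n k" "rgap K n k < rend K n k"
    "lend K (Suc n) (2 * k - 1) = lend K n k" "rend K (Suc n) (2 * k - 1) = lgap K n k"
    "lend K (Suc n) (2 * k) = rgap K n k" "rend K (Suc n) (2 * k) = rend K n k"
  using assms unfolding is_cantor_construction_def by blast+

lemma aperture_ge:
  assumes "k \<in> {1..2 ^ n}"
  shows "ereal ((rgap K n k - lgap K n k) / (lgap K n k - lend K n k)) \<le> aperture K"
    "ereal ((rgap K n k - lgap K n k) / (rend K n k - rgap K n k)) \<le> aperture K"
proof -
  have "ereal (max ((rgap K n k - lgap K n k) / (lgap K n k - lend K n k))
                ((rgap K n k - lgap K n k) / (rend K n k - rgap K n k))) \<le> aperture K"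
    unfolding aperture_def by (rule SUP_upper2[of "(n, k)"]) (use assms in auto)
  then show "ereal ((rgap K n k - lgap K n k) / (lgap K n k - lend K n k)) \<le> aperture K"
    "ereal ((rgap K n k - lgap K n k) / (rend K n k - rgap K n k)) \<le> aperture K"
    by (auto elim!: order_trans[rotated])
qed

lemma aperture_pos:
  assumes "is_cantor_construction x1 x2 K"
  shows "0 < aperture K"
proof -
  have k: "(1 :: nat) \<in> {1..2 ^ 0}" by simp
  have "0 < ereal ((rgap K 0 1 - lgap K 0 1) / (lgap K 0 1 - lend K 0 1))"
    using cantor_construction_step(1,2)[OF assms k] by simp
  with aperture_ge(1)[OF k] show ?thesis by (rule less_le_trans[rotated])
qed

lemma cantor_stage_Suc_subset:
  assumes K: "is_cantor_construction x1 x2 K"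
  shows "cantor_stage K (Suc n) \<subseteq> cantor_stage K n"
proof
  fix x assume "x \<in> cantor_stage K (Suc n)"
  then obtain k where k: "k \<in> {1..2 ^ Suc n}" and x: "x \<in> {lend K (Suc n) k..rend K (Suc n) k}"
    unfolding cantor_stage_def by blast
  define j where "j = (k + 1) div 2"
  have j: "j \<in> {1..2 ^ n}" and kj: "k = 2 * j - 1 \<or> k = 2 * j" using k unfolding j_def by auto
  have "x \<in> {lend K n j..rend K n j}"
    using cantor_construction_step[OF K j] x kj by auto
  then show "x \<in> cantor_stage K n" using j unfolding cantor_stage_def by blast
qed

lemma cantor_stage_antimono:
  assumes "is_cantor_construction x1 x2 K" "m \<le> n"
  shows "cantor_stage K n \<subseteq> cantor_stage K m"
  using lift_Suc_antimono_le[of "cantor_stage K"] cantor_stage_Suc_subset[OF assms(1)] assms(2) by blast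

lemma cantor_stage_subset:
  assumes "is_cantor_construction x1 x2 K"
  shows "cantor_stage K n \<subseteq> {x1..x2}"
  using cantor_stage_antimono[OF assms, of 0 n] assms
  unfolding cantor_stage_def is_cantor_construction_def by auto

lemma gap_complement_join:
  "gap_complement a d (insert (b, c) (V \<union> W)) \<subseteq> gap_complement a b V \<union> gap_complement c d W"
proof
  fix x assume x: "x \<in> gap_complement a d (insert (b, c) (V \<union> W))"
  then have "x \<notin> {b<..<c}" unfolding gap_complement_def by blast
  then have "x \<le> b \<or> c \<le> x" by auto
  then show "x \<in> gap_complement a b V \<union> gap_complement c d W"
    using x unfolding gap_complement_def by auto
qed

text \<open>
  Induction on the number of remaining stages for all intervals simultaneously, so that the gaps
  below an interval are assembled from those below its two children.
\<close>

lemma cantor_interval_gaps_spread: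
  assumes K: "is_cantor_construction x1 x2 K" and r: "0 < r" "aperture K \<le> ereal r"
    and "k \<in> {1..2 ^ m}"
  shows "\<exists>U. finite U \<and> gaps_spread r (lend K m k) (rend K m k) U \<and>
    gap_complement (lend K m k) (rend K m k) U \<subseteq> cantor_stage K (m + n)"
  using assms(4)
proof (induction n arbitrary: m k)
  case 0
  then show ?case
    by (intro exI[of _ "{}"]) (auto simp: gaps_spread_def gap_complement_def cantor_stage_def)
next
  case (Suc n)
  note step = cantor_construction_step[OF K Suc.prems]
  have kids: "2 * k - 1 \<in> {1..2 ^ Suc m}" "2 * k \<in> {1..2 ^ Suc m}" using Suc.prems by auto
  obtain V where V: "finite V" "gaps_spread r (lend K m k) (lgap K m k) V"
      "gap_complement (lend K m k) (lgap K m k) V \<subseteq> cantor_stage K (m + Suc n)"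
    using Suc.IH[OF kids(1)] step by auto
  obtain W where W: "finite W" "gaps_spread r (rgap K m k) (rend K m k) W"
      "gap_complement (rgap K m k) (rend K m k) W \<subseteq> cantor_stage K (m + Suc n)"
    using Suc.IH[OF kids(2)] step by auto
  have "rgap K m k - lgap K m k \<le> r * (lgap K m k - lend K m k)"
    "rgap K m k - lgap K m k \<le> r * (rend K m k - rgap K m k)"
    using order_trans[OF aperture_ge(1)[OF Suc.prems] r(2)]
      order_trans[OF aperture_ge(2)[OF Suc.prems] r(2)] step(1,3)
    by (simp_all add: divide_simps)
  from gaps_spread_join[OF r(1) step(2) this V(2) W(2)] show ?case
    using V(1,3) W(1,3) gap_complement_join[of "lend K m k" "rend K m k" "lgap K m k" "rgap K m k" V W]
    by (intro exI[of _ "insert (lgap K m k, rgap K m k) (V \<union> W)"]) auto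
qed

lemma cantor_level_point:
  assumes r: "0 < r" and x12: "x1 < x2"
    and C: "is_cantor_construction x1 x2 C" "aperture C \<le> ereal r"
    and D: "is_cantor_construction x1 x2 D" "aperture D \<le> ereal r"
    and g: "exchange r {x1..x2} g"
    and cont: "continuous_on ({x1..x2} \<times> {x1..x2}) (\<lambda>z. g (fst z) (snd z))"
    and t: "g x1 x1 \<le> t" "t \<le> g x2 x2"
  shows "\<exists>x\<in>cantor_set C. \<exists>y\<in>cantor_set D. g x y = t"
proof -
  define F where "F n = {z \<in> cantor_stage C n \<times> cantor_stage D n. g (fst z) (snd z) = t}" for n
  have ends: "lend K 0 1 = x1" "rend K 0 1 = x2" if "is_cantor_construction x1 x2 K" for K
    using that unfolding is_cantor_construction_def by auto
  \<comment> \<open>Both intervals have the same length, so each gap is short against the other factor because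
    it is short against its own.\<close>
  have short: "v - u \<le> r * (x2 - x1)" if "gaps_spread r x1 x2 U" "(u, v) \<in> U" for U u v
  proof -
    have "r * (u - x1) \<le> r * (x2 - x1)"
      using r gaps_spread_inside[OF r that] gaps_spreadD(1)[OF that] by (intro mult_left_mono) auto
    with gaps_spreadD(2)[OF that] show ?thesis by linarith
  qed
  have nonempty: "F n \<noteq> {}" for n
  proof -
    obtain U where U: "finite U" "gaps_spread r x1 x2 U" "gap_complement x1 x2 U \<subseteq> cantor_stage C n"
      using cantor_interval_gaps_spread[OF C(1) r C(2), of 1 0 n] ends[OF C(1)] by auto
    obtain V where V: "finite V" "gaps_spread r x1 x2 V" "gap_complement x1 x2 V \<subseteq> cantor_stage D n"
      using cantor_interval_gaps_spread[OF D(1) r D(2), of 1 0 n] ends[OF D(1)] by auto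
    have "linked r g t x1 x2 U x1 x2 V"
      unfolding linked_def using U V short t x12 by auto
    from linked_level_point[OF r this g cont order_refl order_refl]
    show ?thesis using U(3) V(3) unfolding F_def by fastforce
  qed
  have "compact (cantor_stage K n)" for n K
    unfolding cantor_stage_def by (intro compact_UN) auto
  then have cpt: "compact (cantor_stage C n \<times> cantor_stage D n)" for n by (intro compact_Times)
  have sub: "cantor_stage C n \<times> cantor_stage D n \<subseteq> {x1..x2} \<times> {x1..x2}" for n
    using cantor_stage_subset[OF C(1)] cantor_stage_subset[OF D(1)] by blast
  have "compact (F n)" for n
  proof -
    have "closed (F n)"
      unfolding F_def using continuous_on_subset[OF cont sub]
      by (intro continuous_closed_preimage_constant compact_imp_closed cpt)
    then have "compact ((cantor_stage C n \<times> cantor_stage D n) \<inter> F n)"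
      using cpt by (rule compact_Int_closed[rotated])
    moreover have "(cantor_stage C n \<times> cantor_stage D n) \<inter> F n = F n" unfolding F_def by auto
    ultimately show ?thesis by simp
  qed
  moreover have "F n \<subseteq> F m" if "m \<le> n" for m n
    using cantor_stage_antimono[OF C(1) that] cantor_stage_antimono[OF D(1) that]
    unfolding F_def by auto
  ultimately have "\<Inter>(range F) \<noteq> {}" using nonempty by (intro compact_nest) auto
  then obtain z where z: "\<And>n. z \<in> F n" by auto
  have "fst z \<in> cantor_stage C n" "snd z \<in> cantor_stage D n" for n
    using z[of n] unfolding F_def by auto
  then have "fst z \<in> cantor_set C" "snd z \<in> cantor_set D" unfolding cantor_set_def by auto
  moreover have "g (fst z) (snd z) = t" using z unfolding F_def by auto
  ultimately show ?thesis by blast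
qed

section \<open>Monotonicity along segments\<close>

lemma nonneg_deriv_off_finite_imp_le:
  fixes f :: "real \<Rightarrow> real"
  assumes "finite T" "a \<le> b" "continuous_on {a..b} f"
    and deriv: "\<And>x. x \<in> {a<..<b} - T \<Longrightarrow> \<exists>y\<ge>0. (f has_real_derivative y) (at x)"
  shows "f a \<le> f b"
proof -
  define f' where "f' x = (if x \<in> {a<..<b} - T then deriv f x else 0)" for x
  have d: "(f has_real_derivative f' x) (at x) \<and> f' x \<ge> 0" if "x \<in> {a<..<b} - T" for x
    using deriv[OF that] that DERIV_imp_deriv unfolding f'_def by fastforce
  have "(f' has_integral (f b - f a)) {a..b}"
    using assms d by (intro fundamental_theorem_of_calculus_interior_strong[of T])
      (auto simp: has_real_derivative_iff_has_vector_derivative)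
  then have "0 \<le> f b - f a"
    by (rule has_integral_nonneg) (use d in \<open>auto simp: f'_def\<close>)
  then show ?thesis by simp
qed

text \<open>
  The assumption says that \<open>c\<close> does not lie on the line through \<open>p\<close> and \<open>q\<close> (and that \<open>p \<noteq> q\<close>), so
  the shrunken segments lie on distinct parallel lines. A straight arc that is not parallel to them
  meets each at most once; a parallel one meets at most one of them.
\<close>

lemma homothetic_segments_meet_arc_finitely:
  fixes p q c :: "real \<times> real"
  assumes arc: "admissible_arc \<gamma>"
    and c: "(snd q - snd p) * (fst c - fst p) \<noteq> (fst q - fst p) * (snd c - snd p)"
  shows "\<forall>\<^sub>F s in at_right 0. finite (path_image \<gamma> \<inter>
           closed_segment ((1 - s) *\<^sub>R p + s *\<^sub>R c) ((1 - s) *\<^sub>R q + s *\<^sub>R c))"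
proof (cases "\<forall>p q. finite (path_image \<gamma> \<inter> closed_segment p q)")
  case True
  then show ?thesis by (intro always_eventually allI) blast
next
  case False
  then obtain a b where ab: "path_image \<gamma> = closed_segment a b"
    using arc unfolding admissible_arc_def by blast
  \<comment> \<open>The linear functional that vanishes in the direction of the segment and so numbers the parallels.\<close>
  define n where "n = (\<lambda>x :: real \<times> real. (snd q - snd p) * fst x - (fst q - fst p) * snd x)"
  have nseg: "n x = (1 - s) * n p + s * n c"
    if "x \<in> closed_segment ((1 - s) *\<^sub>R p + s *\<^sub>R c) ((1 - s) *\<^sub>R q + s *\<^sub>R c)" for x s
  proof -
    obtain u where x: "x = (1 - u) *\<^sub>R ((1 - s) *\<^sub>R p + s *\<^sub>R c) + u *\<^sub>R ((1 - s) *\<^sub>R q + s *\<^sub>R c)"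
      using \<open>x \<in> _\<close> unfolding closed_segment_def by blast
    show ?thesis unfolding x n_def by (simp add: algebra_simps)
  qed
  have npc: "n c \<noteq> n p" using c unfolding n_def by (simp add: algebra_simps)
  show ?thesis
  proof (cases "n a = n b")
    case False
    have "finite (path_image \<gamma> \<inter>
        closed_segment ((1 - s) *\<^sub>R p + s *\<^sub>R c) ((1 - s) *\<^sub>R q + s *\<^sub>R c))" for s
    proof -
      define w where "w = ((1 - s) * n p + s * n c - n a) / (n b - n a)"
      have "x = (1 - w) *\<^sub>R a + w *\<^sub>R b"
        if x: "x \<in> path_image \<gamma>"
          "x \<in> closed_segment ((1 - s) *\<^sub>R p + s *\<^sub>R c) ((1 - s) *\<^sub>R q + s *\<^sub>R c)" for x
      proof -
        obtain u where u: "x = (1 - u) *\<^sub>R a + u *\<^sub>R b"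
          using x(1) unfolding ab closed_segment_def by auto
        have "n x = n a + u * (n b - n a)" unfolding u n_def by (simp add: algebra_simps)
        then have "u = w" unfolding w_def nseg[OF x(2), symmetric] using False by simp
        then show ?thesis using u by simp
      qed
      then have "path_image \<gamma> \<inter> closed_segment ((1 - s) *\<^sub>R p + s *\<^sub>R c) ((1 - s) *\<^sub>R q + s *\<^sub>R c)
          \<subseteq> {(1 - w) *\<^sub>R a + w *\<^sub>R b}" by blast
      then show ?thesis by (rule finite_subset) simp
    qed
    then show ?thesis by simp
  next
    case True
    have nab: "n x = n a" if x: "x \<in> path_image \<gamma>" for x
    proof -
      obtain u where u: "x = (1 - u) *\<^sub>R a + u *\<^sub>R b"
        using x unfolding ab closed_segment_def by blast
      have "n x = n a + u * (n b - n a)" unfolding u n_def by (simp add: algebra_simps)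
      then show ?thesis using True by simp
    qed
    define s0 where "s0 = (n a - n p) / (n c - n p)"
    have "\<forall>\<^sub>F s in at_right 0. s \<noteq> s0"
      by (rule eventually_neq_at_within)
    then show ?thesis
    proof eventually_elim
      case (elim s)
      have "path_image \<gamma> \<inter>
        closed_segment ((1 - s) *\<^sub>R p + s *\<^sub>R c) ((1 - s) *\<^sub>R q + s *\<^sub>R c) = {}"
      proof (rule ccontr)
        assume "\<not> ?thesis"
        then obtain x where "n x = n a" "n x = (1 - s) * n p + s * n c"
          using nab nseg by blast
        then have "s * (n c - n p) = n a - n p" by (simp add: algebra_simps)
        then have "s = s0" using npc unfolding s0_def by (simp add: eq_divide_eq)
        then show False using elim by simp
      qed
      then show ?case by simp
    qed
  qed
qed

text \<open>
  A line cannot contain three corners of the square, so one of them serves as a centre.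
\<close>

lemma homothetic_segments_meet_arcs_finitely:
  fixes p q :: "real \<times> real"
  assumes x12: "x1 < x2" and pq: "p \<noteq> q"
    and arcs: "finite \<Gamma>" "\<forall>\<gamma>\<in>\<Gamma>. admissible_arc \<gamma>"
  obtains c where "c \<in> {x1..x2} \<times> {x1..x2}"
    "\<forall>\<^sub>F s in at_right 0. finite ((\<Union>\<gamma>\<in>\<Gamma>. path_image \<gamma>) \<inter>
       closed_segment ((1 - s) *\<^sub>R p + s *\<^sub>R c) ((1 - s) *\<^sub>R q + s *\<^sub>R c))"
proof -
  have "\<exists>c\<in>{x1..x2} \<times> {x1..x2}. (snd q - snd p) * (fst c - fst p) \<noteq> (fst q - fst p) * (snd c - snd p)"
  proof (rule ccontr)
    assume "\<not> ?thesis"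
    then have no: "\<forall>c\<in>{x1..x2} \<times> {x1..x2}. (snd q - snd p) * (fst c - fst p) = (fst q - fst p) * (snd c - snd p)"
      by blast
    have "(snd q - snd p) * (x - fst p) = (fst q - fst p) * (y - snd p)"
      if "x \<in> {x1..x2}" "y \<in> {x1..x2}" for x y
      using bspec[OF no, of "(x, y)"] that by simp
    from this[of x1 x1] this[of x2 x1] this[of x1 x2] x12
    have "(snd q - snd p) * (x2 - x1) = 0" "(fst q - fst p) * (x2 - x1) = 0"
      by (auto simp: algebra_simps)
    then show False using pq x12 by (auto simp: prod_eq_iff)
  qed
  then obtain c where c: "c \<in> {x1..x2} \<times> {x1..x2}"
    "(snd q - snd p) * (fst c - fst p) \<noteq> (fst q - fst p) * (snd c - snd p)" by blast
  have "\<forall>\<^sub>F s in at_right 0. \<forall>\<gamma>\<in>\<Gamma>. finite (path_image \<gamma> \<inter>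
       closed_segment ((1 - s) *\<^sub>R p + s *\<^sub>R c) ((1 - s) *\<^sub>R q + s *\<^sub>R c))"
    using homothetic_segments_meet_arc_finitely[OF _ c(2)] arcs
    by (intro eventually_ball_finite) auto
  then have "\<forall>\<^sub>F s in at_right 0. finite ((\<Union>\<gamma>\<in>\<Gamma>. path_image \<gamma>) \<inter>
       closed_segment ((1 - s) *\<^sub>R p + s *\<^sub>R c) ((1 - s) *\<^sub>R q + s *\<^sub>R c))"
  proof eventually_elim
    case (elim s)
    let ?X = "closed_segment ((1 - s) *\<^sub>R p + s *\<^sub>R c) ((1 - s) *\<^sub>R q + s *\<^sub>R c)"
    have "finite (\<Union>\<gamma>\<in>\<Gamma>. path_image \<gamma> \<inter> ?X)" using elim arcs(1) by blast
    moreover have "(\<Union>\<gamma>\<in>\<Gamma>. path_image \<gamma>) \<inter> ?X = (\<Union>\<gamma>\<in>\<Gamma>. path_image \<gamma> \<inter> ?X)" by blast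
    ultimately show ?case by (simp only:)
  qed
  with c(1) show ?thesis by (rule that)
qed

lemma homothety_mem_square:
  fixes p c :: "real \<times> real"
  assumes "p \<in> {x1..x2} \<times> {x1..x2}" "c \<in> {x1..x2} \<times> {x1..x2}" "0 \<le> s" "s \<le> 1"
  shows "(1 - s) *\<^sub>R p + s *\<^sub>R c \<in> {x1..x2} \<times> {x1..x2}"
proof -
  have "convex ({x1..x2} \<times> {x1..x2})" by (intro convex_Times convex_real_interval)
  then show ?thesis by (rule convexD) (use assms in simp_all)
qed

lemma le_along_segment_finite_exceptions:
  fixes g :: "real \<times> real \<Rightarrow> real"
  assumes seg: "closed_segment p q \<subseteq> S" and cont: "continuous_on S g"
    and fin: "finite (E \<inter> closed_segment p q)" and pq: "p \<noteq> q"
    and deriv: "\<And>z. z \<in> S - E \<Longrightarrow> (g has_derivative g' z) (at z within S)"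
    and nonneg: "\<And>z. z \<in> S - E \<Longrightarrow> 0 \<le> g' z (q - p)"
  shows "g p \<le> g q"
proof -
  let ?l = "linepath p q"
  define T where "T = {t \<in> {0..1}. ?l t \<in> E}"
  have l: "?l t \<in> closed_segment p q" if "t \<in> {0..1}" for t
    using that by (metis linepath_in_path)
  have inj: "inj_on ?l T"
    using inj_on_linepath[OF pq] by (rule inj_on_subset) (auto simp: T_def)
  have "?l ` T \<subseteq> E \<inter> closed_segment p q" using l unfolding T_def by auto
  then have T: "finite T" using inj fin finite_imageD finite_subset by blast
  have "(g \<circ> ?l) 0 \<le> (g \<circ> ?l) 1"
  proof (rule nonneg_deriv_off_finite_imp_le[OF T, where f = "g \<circ> ?l"])
    show "continuous_on {0..1} (g \<circ> ?l)"
      using l seg by (intro continuous_on_compose continuous_on_linepath)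
        (auto intro!: continuous_on_subset[OF cont])
  next
    fix t assume t: "t \<in> {0<..<1} - T"
    then have z: "?l t \<in> S - E" using l[of t] seg unfolding T_def by auto
    have "(?l has_derivative (\<lambda>h. h *\<^sub>R (q - p))) (at t within {0..1})"
      using has_vector_derivative_linepath_within[of p q t "{0..1}"]
      unfolding has_vector_derivative_def .
    moreover have "(g has_derivative g' (?l t)) (at (?l t) within ?l ` {0..1})"
      using deriv[OF z] by (rule has_derivative_subset) (use l seg in auto)
    ultimately have "(g \<circ> ?l has_derivative (\<lambda>h. g' (?l t) (h *\<^sub>R (q - p)))) (at t within {0..1})"
      using diff_chain_within unfolding o_def by blast
    moreover have "g' (?l t) (h *\<^sub>R (q - p)) = g' (?l t) (q - p) * h" for h
      using linear_cmul[OF has_derivative_linear[OF deriv[OF z]]] by simp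
    ultimately have "(g \<circ> ?l has_real_derivative g' (?l t) (q - p)) (at t within {0..1})"
      unfolding has_field_derivative_def by simp
    moreover have "at t within {0..1} = at t" using t by (intro at_within_interior) auto
    ultimately show "\<exists>y\<ge>0. (g \<circ> ?l has_real_derivative y) (at t)"
      using nonneg[OF z] by auto
  qed simp
  then show ?thesis by (simp add: linepath_0' linepath_1')
qed

text \<open>
  No information is available on a segment inside an exceptional arc, but the segments close to it
  obtained by homotheties have finitely many exceptional points, and the same direction.
\<close>

lemma le_along_segment:
  fixes g :: "real \<times> real \<Rightarrow> real" and x1 x2 :: real
  defines "S \<equiv> {x1..x2} \<times> {x1..x2}"
  assumes x12: "x1 < x2" and arcs: "finite \<Gamma>" "\<forall>\<gamma>\<in>\<Gamma>. admissible_arc \<gamma>"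
    and p: "p \<in> S" and q: "q \<in> S" and cont: "continuous_on S g"
    and deriv: "\<And>z. z \<in> S - (\<Union>\<gamma>\<in>\<Gamma>. path_image \<gamma>) \<Longrightarrow> (g has_derivative g' z) (at z within S)"
    and nonneg: "\<And>z. z \<in> S - (\<Union>\<gamma>\<in>\<Gamma>. path_image \<gamma>) \<Longrightarrow> 0 \<le> g' z (q - p)"
  shows "g p \<le> g q"
proof (cases "p = q")
  case True
  then show ?thesis by simp
next
  case pq: False
  obtain c where c: "c \<in> S" and fin: "\<forall>\<^sub>F s in at_right 0. finite ((\<Union>\<gamma>\<in>\<Gamma>. path_image \<gamma>) \<inter>
       closed_segment ((1 - s) *\<^sub>R p + s *\<^sub>R c) ((1 - s) *\<^sub>R q + s *\<^sub>R c))"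
    using homothetic_segments_meet_arcs_finitely[OF x12 pq arcs] unfolding S_def by blast
  let ?h = "\<lambda>p s. (1 - s) *\<^sub>R p + s *\<^sub>R c"
  have small: "\<forall>\<^sub>F s in at_right (0 :: real). s \<in> {0<..<1}"
    by (rule eventually_at_right_real) simp
  have hS: "?h z s \<in> S" if "z \<in> S" "s \<in> {0<..<1}" for z s
    using homothety_mem_square[of z x1 x2 c s] that c unfolding S_def by simp
  have le: "\<forall>\<^sub>F s in at_right 0. g (?h p s) \<le> g (?h q s)"
    using fin small
  proof eventually_elim
    case (elim s)
    have dir: "?h q s - ?h p s = (1 - s) *\<^sub>R (q - p)" by (simp add: algebra_simps)
    show ?case
    proof (rule le_along_segment_finite_exceptions[OF _ cont elim(1) _ deriv])
      have "convex S" unfolding S_def by (intro convex_Times convex_real_interval)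
      then show "closed_segment (?h p s) (?h q s) \<subseteq> S"
        using hS p q elim(2) by (simp add: closed_segment_subset)
      show "?h p s \<noteq> ?h q s" using pq elim(2) by simp
      fix z assume z: "z \<in> S - (\<Union>\<gamma>\<in>\<Gamma>. path_image \<gamma>)"
      show "0 \<le> g' z (?h q s - ?h p s)"
        unfolding dir linear_cmul[OF has_derivative_linear[OF deriv[OF z]]]
        using nonneg[OF z] elim(2) by simp
    qed
  qed
  have lim: "((\<lambda>s. g (?h z s)) \<longlongrightarrow> g z) (at_right 0)" if z: "z \<in> S" for z
  proof -
    have "((\<lambda>s. ?h z s) \<longlongrightarrow> (1 - 0) *\<^sub>R z + 0 *\<^sub>R c) (at_right 0)" by (intro tendsto_intros)
    moreover have "\<forall>\<^sub>F s in at_right 0. ?h z s \<in> S"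
      using small by eventually_elim (rule hS[OF z])
    ultimately show ?thesis
      using continuous_on_tendsto_compose[OF cont, of "?h z" z "at_right 0"] z by simp
  qed
  show ?thesis by (rule tendsto_le[OF _ lim[OF q] lim[OF p] le]) simp
qed

text \<open>
  If the arcs covered the square, every continuous function would satisfy the hypotheses of
  \<open>le_along_segment\<close> vacuously for every segment. The first coordinate violates its conclusion.
\<close>

lemma exists_non_exceptional_point:
  assumes x12: "x1 < x2" and arcs: "finite \<Gamma>" "\<forall>\<gamma>\<in>\<Gamma>. admissible_arc \<gamma>"
  shows "({x1..x2} \<times> {x1..x2}) - (\<Union>\<gamma>\<in>\<Gamma>. path_image \<gamma>) \<noteq> {}"
proof
  assume empty: "({x1..x2} \<times> {x1..x2}) - (\<Union>\<gamma>\<in>\<Gamma>. path_image \<gamma>) = {}"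
  have "fst (x2, x1) \<le> fst (x1, x1)"
    by (rule le_along_segment[OF x12 arcs, where g' = "\<lambda>_ _. 0"])
      (use x12 empty in \<open>auto intro: continuous_intros\<close>)
  then show False using x12 by simp
qed

section \<open>Images of products of Cantor sets\<close>

lemma has_derivative_partials:
  fixes g :: "real \<times> real \<Rightarrow> real"
  assumes x12: "x1 < x2" and ab: "a \<in> {x1..x2}" "b \<in> {x1..x2}"
    and g: "(g has_derivative g') (at (a, b) within {x1..x2} \<times> {x1..x2})"
  shows "g' (v, w) = v * partial_fst x1 x2 g a b + w * partial_snd x1 x2 g a b"
proof -
  note lin = has_derivative_linear[OF g]
  have "((\<lambda>s. (s, b)) has_derivative (\<lambda>h. (h, 0))) (at a within {x1..x2})"
    by (auto intro!: derivative_eq_intros)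
  moreover have "(g has_derivative g') (at (a, b) within (\<lambda>s. (s, b)) ` {x1..x2})"
    using g by (rule has_derivative_subset) (use ab in auto)
  ultimately have 1: "((\<lambda>s. g (s, b)) has_derivative (\<lambda>h. g' (h, 0))) (at a within {x1..x2})"
    using diff_chain_within[of "\<lambda>s. (s, b)" _ a "{x1..x2}" g g'] unfolding o_def by blast
  have "((\<lambda>s. (a, s)) has_derivative (\<lambda>h. (0, h))) (at b within {x1..x2})"
    by (auto intro!: derivative_eq_intros)
  moreover have "(g has_derivative g') (at (a, b) within (\<lambda>s. (a, s)) ` {x1..x2})"
    using g by (rule has_derivative_subset) (use ab in auto)
  ultimately have 2: "((\<lambda>s. g (a, s)) has_derivative (\<lambda>h. g' (0, h))) (at b within {x1..x2})"
    using diff_chain_within[of "\<lambda>s. (a, s)" _ b "{x1..x2}" g g'] unfolding o_def by blast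
  have v: "g' (h, 0) = h * g' (1, 0)" and w: "g' (0, h) = h * g' (0, 1)" for h
    using linear_cmul[OF lin, of h "(1, 0)"] linear_cmul[OF lin, of h "(0, 1)"] by simp_all
  have "((\<lambda>s. g (s, b)) has_vector_derivative g' (1, 0)) (at a within {x1..x2})"
    using 1 by (simp only: has_vector_derivative_def real_scaleR_def v[symmetric])
  then have fst: "partial_fst x1 x2 g a b = g' (1, 0)"
    unfolding partial_fst_def by (rule vector_derivative_within_closed_interval[OF x12 ab(1)])
  have "((\<lambda>s. g (a, s)) has_vector_derivative g' (0, 1)) (at b within {x1..x2})"
    using 2 by (simp only: has_vector_derivative_def real_scaleR_def w[symmetric])
  then have snd: "partial_snd x1 x2 g a b = g' (0, 1)"
    unfolding partial_snd_def by (rule vector_derivative_within_closed_interval[OF x12 ab(2)])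
  have "g' (v, w) = g' (v, 0) + g' (0, w)"
    using linear_add[OF lin, of "(v, 0)" "(0, w)"] by simp
  also have "\<dots> = v * g' (1, 0) + w * g' (0, 1)" by (rule arg_cong2[OF v w])
  finally show ?thesis unfolding fst snd .
qed

theorem theorem49:
  fixes x1 x2 :: real
    and C D :: cantor_construction
    and g :: "real \<times> real \<Rightarrow> real"
  assumes "x1 < x2"
    and "is_cantor_construction x1 x2 C"
    and "is_cantor_construction x1 x2 D"
    and "piecewise_C1_on g ({x1..x2} \<times> {x1..x2})"
    and "\<And>\<alpha> \<beta>. \<alpha> \<in> {x1..x2} \<Longrightarrow> \<beta> \<in> {x1..x2} \<Longrightarrow>
           g differentiable (at (\<alpha>, \<beta>) within {x1..x2} \<times> {x1..x2}) \<Longrightarrow>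
           partial_fst x1 x2 g \<alpha> \<beta> > 0 \<and> partial_snd x1 x2 g \<alpha> \<beta> > 0"
    and "\<And>\<alpha> \<beta>. \<alpha> \<in> {x1..x2} \<Longrightarrow> \<beta> \<in> {x1..x2} \<Longrightarrow>
           g differentiable (at (\<alpha>, \<beta>) within {x1..x2} \<times> {x1..x2}) \<Longrightarrow>
           ereal \<bar>partial_fst x1 x2 g \<alpha> \<beta> / partial_snd x1 x2 g \<alpha> \<beta>\<bar>
             \<in> {aperture C..inverse (aperture C)} \<inter> {aperture D..inverse (aperture D)}"
  shows "{g (\<alpha>, \<beta>) | \<alpha> \<beta>. \<alpha> \<in> cantor_set C \<and> \<beta> \<in> cantor_set D} = {g (x1, x1)..g (x2, x2)}"
proof -
  define S where "S = {x1..x2} \<times> {x1..x2}"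
  have cont: "continuous_on S g" using assms(4) unfolding piecewise_C1_on_def S_def by blast
  obtain \<Gamma> where arcs: "finite \<Gamma>" "\<forall>\<gamma>\<in>\<Gamma>. admissible_arc \<gamma>" and
    "\<exists>g' :: real \<times> real \<Rightarrow> (real \<times> real) \<Rightarrow>\<^sub>L real. (\<forall>z \<in> S - (\<Union>\<gamma>\<in>\<Gamma>. path_image \<gamma>).
              (g has_derivative blinfun_apply (g' z)) (at z within S))"
    using assms(4) unfolding piecewise_C1_on_def S_def by blast
  then obtain G :: "real \<times> real \<Rightarrow> (real \<times> real) \<Rightarrow>\<^sub>L real" where
    G: "\<forall>z \<in> S - (\<Union>\<gamma>\<in>\<Gamma>. path_image \<gamma>). (g has_derivative blinfun_apply (G z)) (at z within S)"
    by blast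
  define g' where "g' z = blinfun_apply (G z)" for z
  have deriv: "(g has_derivative g' z) (at z within S)" if "z \<in> S - (\<Union>\<gamma>\<in>\<Gamma>. path_image \<gamma>)" for z
    using G that unfolding g'_def by blast
  define R where "R = S - (\<Union>\<gamma>\<in>\<Gamma>. path_image \<gamma>)"
  define A where "A z = partial_fst x1 x2 g (fst z) (snd z)" for z
  define B where "B z = partial_snd x1 x2 g (fst z) (snd z)" for z
  have g': "g' z (v, w) = v * A z + w * B z" if "z \<in> R" for z v w
    using has_derivative_partials[OF assms(1), of "fst z" "snd z"] deriv[of z] that
    unfolding R_def S_def A_def B_def by auto
  have diff: "fst z \<in> {x1..x2}" "snd z \<in> {x1..x2}"
    "g differentiable (at (fst z, snd z) within {x1..x2} \<times> {x1..x2})" if "z \<in> R" for z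
    using deriv[of z] that unfolding R_def S_def differentiable_def by auto
  have pos: "0 < A z" "0 < B z" if "z \<in> R" for z
    using assms(5)[OF diff[OF that]] unfolding A_def B_def by auto
  have bounds: "aperture C \<le> ereal (A z / B z)" "ereal (A z / B z) \<le> inverse (aperture C)"
    "aperture D \<le> ereal (A z / B z)" "ereal (A z / B z) \<le> inverse (aperture D)" if "z \<in> R" for z
    using assms(6)[OF diff[OF that]] pos[OF that] unfolding A_def B_def by auto
  \<comment> \<open>The aperture ratios are finite because some point of differentiability bounds them.\<close>
  obtain z0 where z0: "z0 \<in> R"
    using exists_non_exceptional_point[OF assms(1) arcs] unfolding R_def S_def by blast
  obtain rC rD where rC: "aperture C = ereal rC" "0 < rC" and rD: "aperture D = ereal rD" "0 < rD"
    using bounds[OF z0] aperture_pos[OF assms(2)] aperture_pos[OF assms(3)]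
    by (cases "aperture C"; cases "aperture D") auto
  define r where "r = max rC rD"
  have r: "0 < r" "aperture C \<le> ereal r" "aperture D \<le> ereal r"
    using rC rD unfolding r_def by auto
  have ratio: "r * B z \<le> A z" "r * A z \<le> B z" if "z \<in> R" for z
  proof -
    have "rC \<le> A z / B z" "A z / B z \<le> inverse rC" "rD \<le> A z / B z" "A z / B z \<le> inverse rD"
      using bounds[OF that] rC rD by simp_all
    then have "r \<le> A z / B z" "A z / B z \<le> inverse r" unfolding r_def max_def by simp_all
    then show "r * B z \<le> A z" "r * A z \<le> B z"
      using pos[OF that] r(1) by (simp_all add: pos_le_divide_eq pos_divide_le_eq field_simps)
  qed
  have le: "g p \<le> g q"
    if "p \<in> S" "q \<in> S" "\<And>z. z \<in> R \<Longrightarrow> 0 \<le> (fst q - fst p) * A z + (snd q - snd p) * B z" for p q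
  proof (rule le_along_segment[OF assms(1) arcs, of p q g g', folded S_def])
    fix z assume "z \<in> S - (\<Union>\<gamma>\<in>\<Gamma>. path_image \<gamma>)"
    then have "z \<in> R" unfolding R_def .
    then show "0 \<le> g' z (q - p)"
      using that(3)[of z] g'[of z "fst q - fst p" "snd q - snd p"] by (simp add: minus_prod_def)
  qed (use that(1,2) cont deriv in \<open>simp_all add: S_def\<close>)
  have mono: "g (a, b) \<le> g (a', b')"
    if "a \<in> {x1..x2}" "b \<in> {x1..x2}" "a' \<in> {x1..x2}" "b' \<in> {x1..x2}" "a \<le> a'" "b \<le> b'" for a b a' b'
  proof (rule le)
    fix z assume "z \<in> R"
    note pos[OF this]
    with that show "0 \<le> (fst (a', b') - fst (a, b)) * A z + (snd (a', b') - snd (a, b)) * B z"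
      by (intro add_nonneg_nonneg mult_nonneg_nonneg) simp_all
  qed (use that in \<open>simp_all add: S_def\<close>)
  have weigh: "x * M \<le> y * N" if "x \<le> r * y" "0 \<le> y" "0 < M" "r * M \<le> N" for x y M N
  proof -
    have "x * M \<le> y * (r * M)"
      using mult_right_mono[OF that(1), of M] that(3) by (simp add: mult_ac)
    also have "\<dots> \<le> y * N" using that by (intro mult_left_mono)
    finally show ?thesis .
  qed
  have "exchange r {x1..x2} (\<lambda>x y. g (x, y))"
    unfolding exchange_def
  proof (intro ballI impI conjI)
    fix a a' b b' assume X: "a \<in> {x1..x2}" "a' \<in> {x1..x2}" "b \<in> {x1..x2}" "b' \<in> {x1..x2}"
      and o: "a \<le> a'" "b \<le> b'"
    show "g (a', b) \<le> g (a, b')" if "a' - a \<le> r * (b' - b)"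
    proof (rule le)
      fix z assume z: "z \<in> R"
      show "0 \<le> (fst (a, b') - fst (a', b)) * A z + (snd (a, b') - snd (a', b)) * B z"
        using weigh[OF that _ pos(1)[OF z] ratio(2)[OF z]] o by (simp add: algebra_simps)
    qed (use X in \<open>auto simp: S_def\<close>)
    show "g (a, b') \<le> g (a', b)" if "b' - b \<le> r * (a' - a)"
    proof (rule le)
      fix z assume z: "z \<in> R"
      show "0 \<le> (fst (a', b) - fst (a, b')) * A z + (snd (a', b) - snd (a, b')) * B z"
        using weigh[OF that _ pos(2)[OF z] ratio(1)[OF z]] o by (simp add: algebra_simps)
    qed (use X in \<open>auto simp: S_def\<close>)
  qed
  note level = cantor_level_point[OF r(1) assms(1,2) r(2) assms(3) r(3) this]
  have sub: "cantor_set K \<subseteq> {x1..x2}" if "is_cantor_construction x1 x2 K" for K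
    using cantor_stage_subset[OF that] unfolding cantor_set_def by blast
  show ?thesis
  proof (intro equalityI subsetI)
    fix t assume "t \<in> {g (\<alpha>, \<beta>) | \<alpha> \<beta>. \<alpha> \<in> cantor_set C \<and> \<beta> \<in> cantor_set D}"
    then obtain a b where ab: "t = g (a, b)" "a \<in> {x1..x2}" "b \<in> {x1..x2}"
      using sub[OF assms(2)] sub[OF assms(3)] by blast
    then show "t \<in> {g (x1, x1)..g (x2, x2)}"
      using mono[of x1 x1 a b] mono[of a b x2 x2] assms(1) by auto
  next
    fix t assume "t \<in> {g (x1, x1)..g (x2, x2)}"
    then have "\<exists>x\<in>cantor_set C. \<exists>y\<in>cantor_set D. g (x, y) = t"
      using cont unfolding S_def by (intro level) simp_all
    then show "t \<in> {g (\<alpha>, \<beta>) | \<alpha> \<beta>. \<alpha> \<in> cantor_set C \<and> \<beta> \<in> cantor_set D}" by blast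
  qed
qed

end
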